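(* Let $G_1, G_2$ be subgroups of an abelian group $\mathcal{G}$ such that $G_2$ is free abelian of finite positive rank $r$ and $G_1 \cap G_2 = \{0\}$. Let $\mathcal{B}$ be a subset of $G_1$ with a minimal complement $M$ in $G_1$. Let $u : G_1 \to G_2$ be a function and $\varphi : G_2 \to \mathbb{Z}^r$ an isomorphism. Let $G_2'$ be a subgroup of $G_2$ of finite index and $g_2 \in G_2$. Let $X$ be a subset of $\mathcal{G}$ containing $\mathcal{B} + G_2$ and contained in $$(\mathcal{B} + G_2) \cup \bigcup_{g_1 \in G_1 \setminus \mathcal{B}} \big(g_1 + \varphi^{-1}(\mathbb{Z}^r_{<\varphi(u(g_1))})\big) \cup \bigcup_{g_1 \in G_1 \setminus \mathcal{B}} \Big(g_1 + \big(\varphi^{-1}(\mathbb{Z}^r_{\geq \varphi(u(g_1))}) \cap (G_2 \setminus (g_2 + G_2'))\big)\Big).$$ Then $u$ admits a $\varphi$-moderation taking values in $G_2'$, and for any such moderation $v'$, the graph $$M_{v'} = \{x + v'(x) : x \in M\}$$ of the restriction of $v'$ to $M$ is a minimal complement of $X$ in $G_1 + G_2$.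
   Context: For an abelian group $G$ and nonempty subsets $W, W' \subseteq G$, $W'$ is a complement of $W$ in $G$ if $W + W' = G$; it is a minimal complement if moreover $W + (W' \setminus \{w'\}) \neq G$ for every $w' \in W'$. Since $G_1 \cap G_2 = \{0\}$, $G_1 + G_2$ is identified with $G_1 \times G_2$ via $(g_1,g_2) \mapsto g_1 + g_2$. $\mathbb{Z}^r$ carries the lexicographic (dictionary) order; $\mathbb{Z}^r_{<a} = \{z : z < a\}$ and $\mathbb{Z}^r_{\geq a} = \{z : z \not< a\}$. A function $v : G_1 \to G_2$ is a $\varphi$-moderation of $u$ if for each $x_0 \in G_1$ the function $x \mapsto \varphi(v(x) + u(x_0 - x))$ on $G_1$ is bounded above in the lexicographic order of $\mathbb{Z}^r$.
   Formalization: The existence of a φ-moderation of u with values in G_2' is claimed only for countable G_1, since it fails e.g. for G_1 = Z × Z^Z, G_2 = Z, u(a,f) = f(a); the minimal complement claim for any such moderation is kept for arbitrary G_1. *)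

theory Defs
  imports "HOL-Algebra.Free_Abelian_Groups" "HOL-Library.Fun_Lexorder" "HOL-Library.Countable_Set"
begin

definition is_complement :: "('a, 'b) monoid_scheme \<Rightarrow> 'a set \<Rightarrow> 'a set \<Rightarrow> bool" where
  "is_complement G W W' \<longleftrightarrow>
     W \<noteq> {} \<and> W' \<noteq> {} \<and> W \<subseteq> carrier G \<and> W' \<subseteq> carrier G \<and> W <#>\<^bsub>G\<^esub> W' = carrier G"

text \<open>The second argument is the set being complemented, the third its complement.\<close>

definition minimal_complement :: "('a, 'b) monoid_scheme \<Rightarrow> 'a set \<Rightarrow> 'a set \<Rightarrow> bool" where
  "minimal_complement G W W' \<longleftrightarrow>
     is_complement G W W' \<and> (\<forall>w'\<in>W'. W <#>\<^bsub>G\<^esub> (W' - {w'}) \<noteq> carrier G)"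

text \<open>The group of integer vectors of length \<open>r\<close>. They are functions on \<open>{..<r}\<close> extended by
  \<open>undefined\<close>, so two of them never differ at an index \<open>\<ge> r\<close>, and \<^const>\<open>less_fun\<close> restricted to
  them is the dictionary order, index \<open>0\<close> being the most significant one.\<close>

definition Zr :: "nat \<Rightarrow> (nat \<Rightarrow> int) monoid" where
  "Zr r = product_group {..<r} (\<lambda>_. integer_group)"

definition Zr_less :: "nat \<Rightarrow> (nat \<Rightarrow> int) \<Rightarrow> (nat \<Rightarrow> int) set" where
  "Zr_less r a = {z \<in> carrier (Zr r). less_fun z a}"

definition Zr_ge :: "nat \<Rightarrow> (nat \<Rightarrow> int) \<Rightarrow> (nat \<Rightarrow> int) set" where
  "Zr_ge r a = {z \<in> carrier (Zr r). \<not> less_fun z a}"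

definition Zr_bdd_above :: "nat \<Rightarrow> (nat \<Rightarrow> int) set \<Rightarrow> bool" where
  "Zr_bdd_above r S \<longleftrightarrow> (\<exists>c\<in>carrier (Zr r). \<forall>z\<in>S. less_fun z c \<or> z = c)"

definition is_moderation ::
  "('a, 'b) monoid_scheme \<Rightarrow> 'a set \<Rightarrow> 'a set \<Rightarrow> nat \<Rightarrow> ('a \<Rightarrow> nat \<Rightarrow> int) \<Rightarrow> ('a \<Rightarrow> 'a) \<Rightarrow> ('a \<Rightarrow> 'a) \<Rightarrow> bool"
where
  "is_moderation G G1 G2 r \<phi> u v \<longleftrightarrow>
     v \<in> G1 \<rightarrow> G2 \<and>
     (\<forall>x0\<in>G1. Zr_bdd_above r ((\<lambda>x. \<phi> (v x \<otimes>\<^bsub>G\<^esub> u (x0 \<otimes>\<^bsub>G\<^esub> inv\<^bsub>G\<^esub> x))) ` G1))"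

text \<open>A moderation need not exist when \<open>G1\<close> is uncountable. Here \<open>G1\<close> is the product of the
  integers with the group of all integer sequences, \<open>G2\<close> is infinite cyclic, and \<open>u\<close> evaluates a
  sequence at an integer; if \<open>v\<close> were a moderation, the sequence \<open>f a = \<bar>a\<bar> - v(-a, 0)\<close> would give
  the unbounded values \<open>v(-a, 0) + u(a, f) = \<bar>a\<bar>\<close>. All group-theoretic hypotheses of the theorem
  hold, and the ones on \<open>\<B>\<close>, \<open>M\<close>, \<open>X\<close>, \<open>G2'\<close> are met by \<open>G1\<close>, \<open>{\<one>}\<close>, the whole group, \<open>G2\<close>.\<close>

lemma no_moderation_uncountable:
  fixes \<G> :: "((int \<times> (int \<Rightarrow> int)) \<times> int) monoid"
  defines "\<G> \<equiv> (integer_group \<times>\<times> product_group UNIV (\<lambda>_. integer_group)) \<times>\<times> integer_group"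
    and "G1 \<equiv> UNIV \<times> {0}"
    and "G2 \<equiv> {(0, \<lambda>_. 0)} \<times> UNIV"
    and "\<phi> \<equiv> \<lambda>h. \<lambda>i\<in>{..<1::nat}. snd h"
    and "u \<equiv> \<lambda>((a, f), _). ((0, \<lambda>_. 0), f a)"
  shows "comm_group \<G>" "subgroup G1 \<G>" "subgroup G2 \<G>" "G1 \<inter> G2 = {\<one>\<^bsub>\<G>\<^esub>}"
    "\<phi> \<in> iso (\<G>\<lparr>carrier := G2\<rparr>) (Zr 1)" "u \<in> G1 \<rightarrow> G2"
    "minimal_complement (\<G>\<lparr>carrier := G1\<rparr>) G1 {\<one>\<^bsub>\<G>\<^esub>}"
    "\<nexists>v. is_moderation \<G> G1 G2 1 \<phi> u v"
proof -
  have mult: "x \<otimes>\<^bsub>\<G>\<^esub> y = ((fst (fst x) + fst (fst y), \<lambda>i. snd (fst x) i + snd (fst y) i), snd x + snd y)"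
    for x y
    by (cases x; cases y) (auto simp: \<G>_def DirProd_def product_group_def)
  have one: "\<one>\<^bsub>\<G>\<^esub> = ((0, \<lambda>_. 0), 0)"
    by (auto simp: \<G>_def DirProd_def product_group_def)
  have carr: "carrier \<G> = UNIV"
    by (auto simp: \<G>_def DirProd_def product_group_def)
  show comm: "comm_group \<G>"
  proof (rule comm_groupI)
    fix x assume "x \<in> carrier \<G>"
    have "((- fst (fst x), \<lambda>i. - snd (fst x) i), - snd x) \<otimes>\<^bsub>\<G>\<^esub> x = \<one>\<^bsub>\<G>\<^esub>"
      by (simp add: mult one)
    then show "\<exists>y\<in>carrier \<G>. y \<otimes>\<^bsub>\<G>\<^esub> x = \<one>\<^bsub>\<G>\<^esub>" using carr by blast
  qed (auto simp: mult one carr algebra_simps)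
  then have grp: "group \<G>" by (simp add: comm_group_def)
  have inv: "inv\<^bsub>\<G>\<^esub> x = ((- fst (fst x), \<lambda>i. - snd (fst x) i), - snd x)" for x
    by (rule group.inv_equality[OF grp]) (auto simp: mult one carr)
  show "subgroup G1 \<G>"
    by (rule group.subgroupI[OF grp]) (auto simp: G1_def carr inv mult)
  show "subgroup G2 \<G>"
    by (rule group.subgroupI[OF grp]) (auto simp: G2_def carr inv mult)
  show "G1 \<inter> G2 = {\<one>\<^bsub>\<G>\<^esub>}"
    by (auto simp: G1_def G2_def one)
  show "u \<in> G1 \<rightarrow> G2"
    by (auto simp: u_def G2_def)
  have "\<phi> \<in> hom (\<G>\<lparr>carrier := G2\<rparr>) (Zr 1)"
    by (rule homI) (auto simp: \<phi>_def Zr_def product_group_def mult)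
  moreover have "bij_betw \<phi> G2 (carrier (Zr 1))"
  proof (rule bij_betw_byWitness[where f' = "\<lambda>z. ((0, \<lambda>_. 0), z 0)"])
    have "\<phi> ((0, \<lambda>_. 0), z 0) = z" if "z \<in> extensional {..<1}" for z
      using that unfolding \<phi>_def by (intro ext) (simp add: extensional_def restrict_def)
    then show "\<forall>z\<in>carrier (Zr 1). \<phi> ((0, \<lambda>_. 0), z 0) = z"
      by (simp add: Zr_def PiE_def)
    show "\<phi> ` G2 \<subseteq> carrier (Zr 1)"
      by (auto simp: \<phi>_def Zr_def split: if_splits)
  qed (auto simp: \<phi>_def G2_def)
  ultimately show "\<phi> \<in> iso (\<G>\<lparr>carrier := G2\<rparr>) (Zr 1)"
    by (simp add: iso_def)
  have "G1 <#>\<^bsub>\<G>\<^esub> {\<one>\<^bsub>\<G>\<^esub>} = G1"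
    by (auto simp: set_mult_def mult one)
  then show "minimal_complement (\<G>\<lparr>carrier := G1\<rparr>) G1 {\<one>\<^bsub>\<G>\<^esub>}"
    by (auto simp: minimal_complement_def is_complement_def set_mult_def one G1_def)
  show "\<nexists>v. is_moderation \<G> G1 G2 1 \<phi> u v"
  proof
    assume "\<exists>v. is_moderation \<G> G1 G2 1 \<phi> u v"
    then obtain v where v: "is_moderation \<G> G1 G2 1 \<phi> u v" by blast
    define x where "x a = ((- a, \<lambda>_. 0) :: int \<times> (int \<Rightarrow> int), 0 :: int)" for a
    define f where "f a = \<bar>a\<bar> - snd (v (x a))" for a
    let ?x0 = "((0, f), 0)"
    have "?x0 \<in> G1" "x a \<in> G1" for a by (auto simp: G1_def x_def)
    then obtain c where c: "\<And>a. less_fun (\<phi> (v (x a) \<otimes>\<^bsub>\<G>\<^esub> u (?x0 \<otimes>\<^bsub>\<G>\<^esub> inv\<^bsub>\<G>\<^esub> x a))) c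
        \<or> \<phi> (v (x a) \<otimes>\<^bsub>\<G>\<^esub> u (?x0 \<otimes>\<^bsub>\<G>\<^esub> inv\<^bsub>\<G>\<^esub> x a)) = c" and cc: "c \<in> carrier (Zr 1)"
      using v unfolding is_moderation_def Zr_bdd_above_def by blast
    have val: "\<phi> (v (x a) \<otimes>\<^bsub>\<G>\<^esub> u (?x0 \<otimes>\<^bsub>\<G>\<^esub> inv\<^bsub>\<G>\<^esub> x a)) = (\<lambda>i\<in>{..<1}. \<bar>a\<bar>)" for a
      by (simp add: \<phi>_def u_def mult inv x_def f_def)
    have "c i = undefined" if "i \<ge> 1" for i
      using cc that by (simp add: Zr_def PiE_def extensional_def)
    then have k0: "k = 0" if "(\<lambda>i\<in>{..<1::nat}. \<bar>a\<bar>) k < c k" for a k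
      using that by (cases k) auto
    have "\<bar>a\<bar> \<le> c 0" for a
    proof (cases "(\<lambda>i\<in>{..<1::nat}. \<bar>a\<bar>) = c")
      case True
      then have "c 0 = (\<lambda>i\<in>{..<1::nat}. \<bar>a\<bar>) 0" by (rule arg_cong[OF sym])
      then show ?thesis by simp
    next
      case False
      then obtain k where k: "(\<lambda>i\<in>{..<1::nat}. \<bar>a\<bar>) k < c k"
        using c[of a] unfolding val less_fun_def by blast
      then have "k = 0" by (rule k0)
      then show ?thesis using k by simp
    qed
    from this[of "\<bar>c 0\<bar> + 1"] show False by linarith
  qed
qed

end

theory Submission
  imports Defs
begin

text \<open>Everything is read off the leading coordinate \<open>p g = \<phi> g 0\<close>, a homomorphism from \<open>G2\<close> to the
  integers which is monotone for the dictionary order and which, \<open>G2'\<close> having finite index, is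
  unbounded in both directions on \<open>G2'\<close>. If \<open>G1\<close> is enumerated as \<open>e 0, e 1, \<dots>\<close>, let \<open>v (e n)\<close> be an
  element of \<open>G2'\<close> on which \<open>p\<close> is so negative that \<open>p (v (e n) + u (e k - e n)) \<le> 0\<close> for all
  \<open>k \<le> n\<close>; this is a moderation. For minimality, let \<open>m \<in> M\<close> and let \<open>g \<in> G1\<close> lie outside
  \<open>\<B> + (M - {m})\<close>. If \<open>t \<in> g2 + G2'\<close> has \<open>p t\<close> above the bound that moderation gives at \<open>g\<close>, then
  \<open>g + t\<close> is in no \<open>X + x + v' x\<close> with \<open>m \<noteq> x \<in> M\<close>: the element \<open>t - v' x\<close> is too large for the
  lower part of the fibre of \<open>X\<close> over \<open>g - x\<close>, and it lies in the coset that the upper part avoids.\<close>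

section \<open>Integer-valued homomorphisms on subgroups of finite index\<close>

text \<open>Pigeonhole: two powers of \<open>x\<close> share a coset of \<open>H\<close>, and the
  power by the difference of their exponents lies in \<open>H\<close>.\<close>

lemma finite_index_pow:
  fixes G (structure)
  assumes "group G" and H: "subgroup H G" and fin: "finite (rcosets H)" and x: "x \<in> carrier G"
  shows "\<exists>n::nat > 0. x [^] n \<in> H"
proof -
  interpret group G by fact
  have "range (\<lambda>n::nat. H #> x [^] n) \<subseteq> rcosets H"
    using x by (auto simp: RCOSETS_def)
  then have "\<not> inj (\<lambda>n::nat. H #> x [^] n)"
    using fin finite_imageD finite_subset by blast
  then obtain k l :: nat where "k \<noteq> l" "H #> x [^] k = H #> x [^] l"
    unfolding inj_def by blast
  then obtain i j :: nat where ij: "i < j" "H #> x [^] i = H #> x [^] j"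
    by (cases k l rule: linorder_cases) simp_all
  have "x [^] j \<in> H #> x [^] i"
    using ij x H by (simp add: rcos_self)
  then obtain h where h: "h \<in> H" "x [^] j = h \<otimes> x [^] i"
    by (auto simp: r_coset_def)
  have "x [^] (j - i) \<otimes> x [^] i = h \<otimes> x [^] i"
    using ij x h by (simp add: nat_pow_mult)
  then have "x [^] (j - i) \<in> H"
    using x h subgroup.mem_carrier[OF H] by simp
  with ij show ?thesis by (intro exI[of _ "j - i"]) simp
qed

text \<open>Some power \<open>x [^] n\<close> with \<open>n > 0\<close> lies in \<open>H\<close>;
  its value \<open>n * p x\<close> is an integer of size at least 1, so its own powers pass any
  bound.\<close>

lemma hom_int_unbounded_on_finite_index:
  fixes G (structure)
  assumes G: "group G" and H: "subgroup H G" and fin: "finite (rcosets H)"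
    and p: "p \<in> hom G integer_group" and x: "x \<in> carrier G" "p x > 0"
  shows "\<exists>e\<in>H. p e \<ge> N"
proof -
  interpret group G by fact
  interpret p: group_hom G integer_group p
    by (rule group_hom.intro) (auto simp: group_hom_axioms_def p)
  have p_pow: "p (y [^] k) = int k * p y" if "y \<in> carrier G" for y and k :: nat
    using that by (induction k) (simp_all add: algebra_simps)
  obtain n :: nat where n: "n > 0" "x [^] n \<in> H"
    using finite_index_pow[OF G H fin x(1)] by blast
  define k where "k = nat \<bar>N\<bar>"
  have "p ((x [^] n) [^] k) = int k * (int n * p x)"
    using x by (simp add: p_pow)
  moreover have "0 < int n * p x"
    using n(1) x(2) by simp
  then have "int k * (int n * p x) \<ge> int k * 1"
    by (intro mult_left_mono) auto
  moreover have "(x [^] n) [^] k \<in> H"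
    using H n(2) by (induction k) (auto simp: subgroup.one_closed subgroup.m_closed)
  moreover have "int k \<ge> N" by (simp add: k_def)
  ultimately show ?thesis by force
qed

section \<open>The leading coordinate in the dictionary order\<close>

lemma less_fun_imp_le_at_0:
  fixes f g :: "nat \<Rightarrow> 'c::linorder"
  assumes "less_fun f g"
  shows "f 0 \<le> g 0"
proof -
  obtain k where k: "f k < g k" "\<And>k'. k' < k \<Longrightarrow> f k' = g k'"
    using assms by (auto simp: less_fun_def)
  show ?thesis using k by (cases k) auto
qed

lemma less_fun_at_0:
  fixes f g :: "nat \<Rightarrow> 'c::linorder"
  shows "f 0 < g 0 \<Longrightarrow> less_fun f g"
  by (auto simp: less_fun_def)

lemma Zr_bdd_above_iff_at_0:
  assumes "0 < r"
  shows "Zr_bdd_above r S \<longleftrightarrow> (\<exists>C. \<forall>z\<in>S. z 0 \<le> C)"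
proof
  assume "Zr_bdd_above r S"
  then show "\<exists>C. \<forall>z\<in>S. z 0 \<le> C"
    unfolding Zr_bdd_above_def by (metis less_fun_imp_le_at_0 order_refl)
next
  assume "\<exists>C. \<forall>z\<in>S. z 0 \<le> C"
  then obtain C where C: "\<And>z. z \<in> S \<Longrightarrow> z 0 \<le> C" by blast
  \<comment> \<open>With \<open>C + 1\<close> the comparison is already strict at index
    \<open>0\<close>, so the later coordinates of \<open>z\<close> may be arbitrary.\<close>
  let ?c = "\<lambda>i\<in>{..<r}. C + 1"
  have "?c \<in> carrier (Zr r)" by (auto simp: Zr_def)
  moreover have "less_fun z ?c" if "z \<in> S" for z
    using C[OF that] assms by (intro less_fun_at_0) auto
  ultimately show "Zr_bdd_above r S" unfolding Zr_bdd_above_def by blast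
qed

section \<open>Bounding countably many functions at once\<close>

text \<open>Diagonal argument: the value at the point numbered \<open>n x\<close> is chosen against
  the finitely many functions numbered up to \<open>n x\<close>. For a fixed \<open>x0\<close> this
  leaves only finitely many points uncontrolled.\<close>

lemma countable_diagonal_bound:
  fixes p :: "'b \<Rightarrow> int"
  assumes A: "countable A" and E: "\<And>N. \<exists>y\<in>E. p y \<le> N"
  shows "\<exists>v. (\<forall>x. v x \<in> E) \<and> (\<forall>x0\<in>A. \<exists>C. \<forall>x\<in>A. p (v x) + w x0 x \<le> C)"
proof -
  define e where "e = from_nat_into A"
  define n where "n = to_nat_on A"
  have en: "e (n x) = x" if "x \<in> A" for x
    using that A by (simp add: e_def n_def)
  have "\<exists>v. \<forall>x. v x \<in> E \<and> p (v x) \<le> - (\<Sum>k\<le>n x. \<bar>w (e k) x\<bar>)"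
    by (intro choice allI) (use E in blast)
  then obtain v where v: "\<And>x. v x \<in> E" "\<And>x. p (v x) \<le> - (\<Sum>k\<le>n x. \<bar>w (e k) x\<bar>)"
    by blast
  have nonpos: "p (v x) + w (e k) x \<le> 0" if "k \<le> n x" for k x
  proof -
    have "\<bar>w (e k) x\<bar> \<le> (\<Sum>k\<le>n x. \<bar>w (e k) x\<bar>)"
      using that by (intro member_le_sum[where f = "\<lambda>k. \<bar>w (e k) x\<bar>"]) simp_all
    then show ?thesis using v(2)[of x] by linarith
  qed
  have "\<exists>C. \<forall>x\<in>A. p (v x) + w x0 x \<le> C" if x0: "x0 \<in> A" for x0
  proof (intro exI ballI)
    fix x assume x: "x \<in> A"
    let ?f = "\<lambda>x. p (v x) + w x0 x"
    \<comment> \<open>The uncontrolled points are those numbered below \<open>n x0\<close>; the sum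
      dominates the value at each of them, and all other values are at most
      \<open>0\<close>.\<close>
    let ?C = "\<Sum>k<n x0. \<bar>?f (e k)\<bar>"
    show "?f x \<le> ?C"
    proof (cases "n x0 \<le> n x")
      case True
      then have "?f x \<le> 0" using nonpos[OF True] en[OF x0] by simp
      also have "0 \<le> ?C" by (simp add: sum_nonneg)
      finally show ?thesis .
    next
      case False
      then have "\<bar>?f (e (n x))\<bar> \<le> ?C"
        by (intro member_le_sum[where f = "\<lambda>k. \<bar>?f (e k)\<bar>"]) simp_all
      then show ?thesis using en[OF x] by simp
    qed
  qed
  with v(1) show ?thesis by blast
qed

section \<open>Graphs over \<open>M\<close> as minimal complements\<close>

lemma set_multI: "a \<in> A \<Longrightarrow> b \<in> B \<Longrightarrow> a \<otimes>\<^bsub>G\<^esub> b \<in> A <#>\<^bsub>G\<^esub> B"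
  by (auto simp: set_mult_def)

text \<open>The fibres of \<open>X\<close> over \<open>B\<close> are all of \<open>G2\<close>, so
  whatever \<open>v x\<close> contributes can be corrected inside the fibre over
  \<open>b\<close>.\<close>

lemma graph_complement:
  fixes G (structure)
  assumes "comm_group G" and G1: "subgroup G1 G" and G2: "subgroup G2 G"
    and BM: "B \<subseteq> G1" "M \<subseteq> G1" "B <#> M = G1"
    and X: "B <#> G2 \<subseteq> X" "X \<subseteq> G1 <#> G2" and v: "v \<in> M \<rightarrow> G2"
  shows "X <#> {x \<otimes> v x |x. x \<in> M} = G1 <#> G2"
proof
  interpret comm_group G by fact
  interpret G1: subgroup G1 G by fact
  interpret G2: subgroup G2 G by fact
  interpret G12: subgroup "G1 <#> G2" G by (rule mult_subgroups[OF G1 G2])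
  have "x \<otimes> v x \<in> G1 <#> G2" if "x \<in> M" for x
    using that BM(2) v by (intro set_multI) auto
  then show "X <#> {x \<otimes> v x |x. x \<in> M} \<subseteq> G1 <#> G2"
    using X(2) unfolding set_mult_def[of _ X] by blast
  show "G1 <#> G2 \<subseteq> X <#> {x \<otimes> v x |x. x \<in> M}"
  proof
    fix y assume "y \<in> G1 <#> G2"
    then obtain a t where y: "y = a \<otimes> t" "a \<in> G1" "t \<in> G2" by (auto simp: set_mult_def)
    then obtain b x where bx: "a = b \<otimes> x" "b \<in> B" "x \<in> M"
      using BM(3) by (auto simp: set_mult_def)
    have mem: "b \<in> G1" "x \<in> G1" "v x \<in> G2"
      using bx BM v by auto
    \<comment> \<open>\<open>inv (v x) \<otimes> v x\<close> stays uncancelled here, so that both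
      sides are rearrangements of the same factors.\<close>
    have "(b \<otimes> (t \<otimes> inv (v x))) \<otimes> (x \<otimes> v x) = (b \<otimes> x) \<otimes> (t \<otimes> (inv (v x) \<otimes> v x))"
      using mem y(3) by (simp add: m_ac del: l_inv)
    then have "y = (b \<otimes> (t \<otimes> inv (v x))) \<otimes> (x \<otimes> v x)"
      using mem y bx by simp
    moreover have "b \<otimes> (t \<otimes> inv (v x)) \<in> X"
      using bx(2) mem(3) y(3) by (intro subsetD[OF X(1)] set_multI) simp_all
    ultimately show "y \<in> X <#> {x \<otimes> v x |x. x \<in> M}"
      using bx(3) by (auto intro: set_multI)
  qed
qed

text \<open>The separation hypothesis makes \<open>g + t\<close> coverable by \<open>X + (x + v x)\<close> only if \<open>B + x\<close> covers
  \<open>g\<close>. Hence a point of \<open>M\<close> that \<open>B + M\<close> cannot spare is not dispensable on the graph either.\<close>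

lemma graph_minimal_complement:
  fixes G (structure)
  assumes G: "comm_group G" and G1: "subgroup G1 G" and G2: "subgroup G2 G" and B: "B \<subseteq> G1"
    and M: "minimal_complement (G\<lparr>carrier := G1\<rparr>) B M"
    and X: "B <#> G2 \<subseteq> X" "X \<subseteq> G1 <#> G2" and v: "v \<in> M \<rightarrow> G2"
    and separation: "\<And>g. g \<in> G1 \<Longrightarrow> \<exists>t\<in>G2. \<forall>x\<in>M. g \<otimes> inv x \<notin> B \<longrightarrow>
      (g \<otimes> inv x) \<otimes> (t \<otimes> inv (v x)) \<notin> X"
  shows "minimal_complement (G\<lparr>carrier := G1 <#> G2\<rparr>) X {x \<otimes> v x |x. x \<in> M}"
    (is "minimal_complement _ X ?M")
proof -
  interpret comm_group G by fact
  interpret G1: subgroup G1 G by fact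
  interpret G2: subgroup G2 G by fact
  have set_mult_carrier: "A <#>\<^bsub>G\<lparr>carrier := C\<rparr>\<^esub> D = A <#> D" for A C D
    by (simp add: set_mult_def)
  have MG: "M \<subseteq> G1" "M \<noteq> {}" "B \<noteq> {}" and BM: "B <#> M = G1"
    and Mmin: "\<And>m. m \<in> M \<Longrightarrow> B <#> (M - {m}) \<noteq> G1"
    using M by (simp_all add: minimal_complement_def is_complement_def set_mult_carrier)
  have XM: "X <#> ?M = G1 <#> G2"
    by (rule graph_complement[OF G G1 G2 B MG(1) BM X v])
  have "X <#> (?M - {m \<otimes> v m}) \<noteq> G1 <#> G2" if m: "m \<in> M" for m
  proof
    assume eq: "X <#> (?M - {m \<otimes> v m}) = G1 <#> G2"
    have "B <#> (M - {m}) \<subseteq> B <#> M" by (auto simp: set_mult_def)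
    then obtain g where g: "g \<in> G1" "g \<notin> B <#> (M - {m})"
      using Mmin[OF m] BM by blast
    obtain t where t: "t \<in> G2"
      "\<And>x. x \<in> M \<Longrightarrow> g \<otimes> inv x \<notin> B \<Longrightarrow> (g \<otimes> inv x) \<otimes> (t \<otimes> inv (v x)) \<notin> X"
      using separation[OF g(1)] by blast
    have "g \<otimes> t \<in> X <#> (?M - {m \<otimes> v m})"
      unfolding eq using g(1) t(1) by (rule set_multI)
    \<comment> \<open>A graph point other than \<open>m \<otimes> v m\<close> must have a base point
      \<open>x \<noteq> m\<close>.\<close>
    then obtain y x where yx: "y \<in> X" "x \<in> M" "x \<noteq> m" "g \<otimes> t = y \<otimes> (x \<otimes> v x)"
      by (auto simp: set_mult_def)
    have "x \<in> G1" "v x \<in> G2" "y \<in> carrier G"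
      using yx MG(1) v X(2) mult_subgroups[OF G1 G2] by (auto dest: subgroup.mem_carrier)
    then have car: "g \<in> carrier G" "t \<in> carrier G" "x \<in> carrier G" "v x \<in> carrier G" "y \<in> carrier G"
      using g(1) t(1) by simp_all
    have "g \<otimes> inv x \<notin> B"
    proof
      assume "g \<otimes> inv x \<in> B"
      then have "(g \<otimes> inv x) \<otimes> x \<in> B <#> (M - {m})"
        using yx(2,3) by (intro set_multI) simp_all
      with g(2) car show False by (simp add: m_assoc)
    qed
    moreover have "y = (g \<otimes> t) \<otimes> inv (x \<otimes> v x)"
      using yx(4) car by (subst inv_solve_right) simp_all
    then have "y = (g \<otimes> inv x) \<otimes> (t \<otimes> inv (v x))"
      using car by (simp add: inv_mult m_ac)
    ultimately show False using t(2)[OF yx(2)] yx(1) by simp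
  qed
  moreover have "?M \<subseteq> G1 <#> G2"
    using MG(1) v by (auto intro!: set_multI)
  moreover obtain b where "b \<in> B" using MG(3) by blast
  then have "X \<noteq> {}" using X(1) set_multI[OF _ G2.one_closed, of b B G] by blast
  moreover have "?M \<noteq> {}" using MG(2) by blast
  ultimately show ?thesis
    using XM X(2) unfolding minimal_complement_def is_complement_def set_mult_carrier by auto
qed

section \<open>Existence of moderations and minimality of their graphs\<close>

theorem theorem5p12:
  fixes \<G> :: "('a, 'b) monoid_scheme" (structure)
    and G1 G2 G2' \<B> M X :: "'a set"
    and r :: nat
    and u :: "'a \<Rightarrow> 'a"
    and \<phi> :: "'a \<Rightarrow> nat \<Rightarrow> int"
    and g2 :: 'a
  assumes "comm_group \<G>"
    and "subgroup G1 \<G>" and "subgroup G2 \<G>"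
    and "0 < r"
    and "\<G>\<lparr>carrier := G2\<rparr> \<cong> free_Abelian_group {..<r}"
    and "G1 \<inter> G2 = {\<one>}"
    and "\<B> \<subseteq> G1"
    and "minimal_complement (\<G>\<lparr>carrier := G1\<rparr>) \<B> M"
    and "u \<in> G1 \<rightarrow> G2"
    and "\<phi> \<in> iso (\<G>\<lparr>carrier := G2\<rparr>) (Zr r)"
    and "subgroup G2' (\<G>\<lparr>carrier := G2\<rparr>)"
    and "finite (rcosets\<^bsub>\<G>\<lparr>carrier := G2\<rparr>\<^esub> G2')"
    and "g2 \<in> G2"
    and "\<B> <#> G2 \<subseteq> X"
    and "X \<subseteq> (\<B> <#> G2)
           \<union> (\<Union>g1\<in>G1 - \<B>. g1 <# (\<phi> -` Zr_less r (\<phi> (u g1)) \<inter> G2))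
           \<union> (\<Union>g1\<in>G1 - \<B>. g1 <# ((\<phi> -` Zr_ge r (\<phi> (u g1)) \<inter> G2) \<inter> (G2 - (g2 <# G2'))))"
  shows "(countable G1 \<longrightarrow> (\<exists>v. is_moderation \<G> G1 G2 r \<phi> u v \<and> v \<in> G1 \<rightarrow> G2')) \<and>
    (\<forall>v'. is_moderation \<G> G1 G2 r \<phi> u v' \<and> v' \<in> G1 \<rightarrow> G2' \<longrightarrow>
       minimal_complement (\<G>\<lparr>carrier := G1 <#> G2\<rparr>) X {x \<otimes> v' x |x. x \<in> M})"
proof -
  interpret comm_group \<G> by fact
  interpret G1: subgroup G1 \<G> by fact
  interpret G2: subgroup G2 \<G> by fact
  interpret H2: group "\<G>\<lparr>carrier := G2\<rparr>" using assms(3) by (rule subgroup_imp_group)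
  interpret G2': subgroup G2' \<G> using assms(3,11) by (rule incl_subgroup)
  interpret group_disjoint_sum \<G> G1 G2 ..
  note r = \<open>0 < r\<close> and u = \<open>u \<in> G1 \<rightarrow> G2\<close>
  \<comment> \<open>Uniqueness of components makes the fibre of \<open>X\<close> over a point of
    \<open>G1\<close> well determined.\<close>
  have direct: "a = a' \<and> b = b'"
    if "a \<otimes> b = a' \<otimes> b'" "a \<in> G1" "b \<in> G2" "a' \<in> G1" "b' \<in> G2" for a b a' b'
    using iffD1[OF cancel equalityD1[OF assms(6)]] that by blast
  have sub': "G2' \<subseteq> G2" using subgroup.subset[OF assms(11)] by simp

  define p where "p = (\<lambda>g. \<phi> g 0)"
  have \<phi>hom: "\<phi> \<in> hom (\<G>\<lparr>carrier := G2\<rparr>) (Zr r)" and \<phi>img: "\<phi> ` G2 = carrier (Zr r)"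
    using \<open>\<phi> \<in> iso _ _\<close> by (simp_all add: iso_def bij_betw_def)
  have p_mult: "p (a \<otimes> b) = p a + p b" if "a \<in> G2" "b \<in> G2" for a b
    using hom_mult[OF \<phi>hom, of a b] that r by (simp add: p_def Zr_def product_group_def)
  have p_hom: "p \<in> hom (\<G>\<lparr>carrier := G2\<rparr>) integer_group"
    by (rule homI) (simp_all add: p_mult)
  have p_inv: "p (inv a) = - p a" if "a \<in> G2" for a
    using p_mult[of a "inv a"] p_mult[of \<one> \<one>] that by simp
  \<comment> \<open>A preimage of the all-ones vector has \<open>p\<close>-value 1, as
    \<open>large\<close> requires some positive value.\<close>
  have "(\<lambda>i\<in>{..<r}. 1) \<in> \<phi> ` G2" by (simp add: \<phi>img Zr_def)
  then obtain h where "h \<in> G2" "(\<lambda>i\<in>{..<r}. 1) = \<phi> h" by (rule imageE)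
  then have "h \<in> G2" "p h = 1" using r by (simp_all add: p_def flip: \<open>_ = \<phi> h\<close>)
  then have large: "\<exists>e\<in>G2'. p e \<ge> N" for N
    using hom_int_unbounded_on_finite_index[OF H2.group_axioms assms(11,12) p_hom, of h] by simp
  have moder: "is_moderation \<G> G1 G2 r \<phi> u v \<longleftrightarrow>
      (\<forall>x0\<in>G1. \<exists>C. \<forall>x\<in>G1. p (v x) + p (u (x0 \<otimes> inv x)) \<le> C)" if v: "v \<in> G1 \<rightarrow> G2" for v
  proof -
    have "\<phi> (v x \<otimes> u (x0 \<otimes> inv x)) 0 = p (v x) + p (u (x0 \<otimes> inv x))"
      if "x \<in> G1" "x0 \<in> G1" for x x0
      using p_mult[OF funcset_mem[OF v] funcset_mem[OF u]] that by (simp add: p_def)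
    with v show ?thesis
      by (simp add: is_moderation_def Zr_bdd_above_iff_at_0[OF r])
  qed
  have into_G2: "v \<in> G1 \<rightarrow> G2" if "v \<in> G1 \<rightarrow> G2'" for v
    using that sub' by blast

  have "\<exists>v. is_moderation \<G> G1 G2 r \<phi> u v \<and> v \<in> G1 \<rightarrow> G2'" if cnt: "countable G1"
  proof -
    have "\<exists>e\<in>G2'. p e \<le> N" for N
    proof -
      obtain e where e: "e \<in> G2'" "p e \<ge> - N" using large by blast
      moreover from e(1) have "p (inv e) = - p e" using sub' p_inv by blast
      ultimately show ?thesis by (intro bexI[of _ "inv e"]) simp_all
    qed
    from countable_diagonal_bound[OF cnt this, of "\<lambda>x0 x. p (u (x0 \<otimes> inv x))"]
    obtain v where v: "\<And>x. v x \<in> G2'"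
      "\<forall>x0\<in>G1. \<exists>C. \<forall>x\<in>G1. p (v x) + p (u (x0 \<otimes> inv x)) \<le> C" by blast
    then have "v \<in> G1 \<rightarrow> G2'" by simp
    with v(2) moder[OF into_G2] show ?thesis by blast
  qed
  moreover have "minimal_complement (\<G>\<lparr>carrier := G1 <#> G2\<rparr>) X {x \<otimes> v x |x. x \<in> M}"
    if mod: "is_moderation \<G> G1 G2 r \<phi> u v" and v: "v \<in> G1 \<rightarrow> G2'" for v
  proof (rule graph_minimal_complement[OF assms(1,2,3,7,8,14)])
    have M: "M \<subseteq> G1"
      using assms(8) by (simp add: minimal_complement_def is_complement_def)
    then show "v \<in> M \<rightarrow> G2" using into_G2[OF v] by blast
    \<comment> \<open>The strict dictionary inequality is weakened to one between leading
      coordinates; the strict bound on the chosen \<open>t\<close> below still contradicts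
      it.\<close>
    have X_cases: "\<exists>a\<in>G1. \<exists>b\<in>G2. y = a \<otimes> b \<and> (a \<in> \<B> \<or> p b \<le> p (u a) \<or> b \<notin> g2 <# G2')"
      if "y \<in> X" for y
    proof -
      have lt: "p b \<le> p (u a)" if "\<phi> b \<in> Zr_less r (\<phi> (u a))" for a b
        using that less_fun_imp_le_at_0[of "\<phi> b" "\<phi> (u a)"] by (simp add: Zr_less_def p_def)
      consider a b where "a \<in> \<B>" "b \<in> G2" "y = a \<otimes> b"
        | a b where "a \<in> G1" "\<phi> b \<in> Zr_less r (\<phi> (u a))" "b \<in> G2" "y = a \<otimes> b"
        | a b where "a \<in> G1" "b \<in> G2" "b \<notin> g2 <# G2'" "y = a \<otimes> b"
        using subsetD[OF assms(15) \<open>y \<in> X\<close>] unfolding set_mult_def l_coset_def by blast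
      then show ?thesis
        by cases (use lt assms(7) in blast)+
    qed
    then show "X \<subseteq> G1 <#> G2"
      unfolding set_mult_def by blast
    fix g assume g: "g \<in> G1"
    obtain C where C: "\<And>x. x \<in> G1 \<Longrightarrow> p (v x) + p (u (g \<otimes> inv x)) \<le> C"
      using mod g unfolding moder[OF into_G2[OF v]] by blast
    \<comment> \<open>Shifting by \<open>g2\<close> puts \<open>g2 \<otimes> s\<close> in the
      avoided coset; the summand 1 places its \<open>p\<close>-value strictly above
      \<open>C\<close>.\<close>
    obtain s where s: "s \<in> G2'" "p s \<ge> C + 1 - p g2" using large by blast
    have "s \<in> G2" using s(1) sub' by blast
    have t: "g2 \<otimes> s \<in> G2" "p (g2 \<otimes> s) > C"
      using s(2) \<open>s \<in> G2\<close> \<open>g2 \<in> G2\<close> p_mult[of g2 s] by simp_all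
    have "(g \<otimes> inv x) \<otimes> (g2 \<otimes> s \<otimes> inv (v x)) \<notin> X" if x: "x \<in> M" "g \<otimes> inv x \<notin> \<B>" for x
    proof
      let ?b = "g2 \<otimes> s \<otimes> inv (v x)"
      assume "(g \<otimes> inv x) \<otimes> ?b \<in> X"
      then obtain a b where ab: "a \<in> G1" "b \<in> G2" "(g \<otimes> inv x) \<otimes> ?b = a \<otimes> b"
        and ab_cases: "a \<in> \<B> \<or> p b \<le> p (u a) \<or> b \<notin> g2 <# G2'"
        using X_cases by blast
      have "x \<in> G1" using x(1) M by blast
      have "v x \<in> G2'" using v \<open>x \<in> G1\<close> by (rule funcset_mem)
      then have "v x \<in> G2" using sub' by blast
      have "a = g \<otimes> inv x" "b = ?b"
        using direct[OF ab(3)] ab(1,2) g \<open>x \<in> G1\<close> \<open>v x \<in> G2\<close> t(1) by simp_all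
      \<comment> \<open>Moderation at \<open>g\<close> gives
        \<open>p (u (g \<otimes> inv x)) \<le> C - p (v x)\<close>, which is less than
        \<open>p ?b\<close>.\<close>
      moreover have "\<not> p ?b \<le> p (u (g \<otimes> inv x))"
        using C[OF \<open>x \<in> G1\<close>] t p_mult[of "g2 \<otimes> s" "inv (v x)"] p_inv[OF \<open>v x \<in> G2\<close>] \<open>v x \<in> G2\<close>
        by simp
      \<comment> \<open>Since \<open>v x\<close> lies in \<open>G2'\<close>, subtracting it does not
        leave the coset of \<open>g2\<close>.\<close>
      moreover have "?b = g2 \<otimes> (s \<otimes> inv (v x))"
        using \<open>g2 \<in> G2\<close> \<open>s \<in> G2\<close> \<open>v x \<in> G2\<close> by (simp add: m_assoc)
      then have "?b \<in> g2 <# G2'"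
        using s(1) \<open>v x \<in> G2'\<close> unfolding l_coset_def by blast
      ultimately show False using ab_cases x(2) by blast
    qed
    with t(1) show "\<exists>t\<in>G2. \<forall>x\<in>M. g \<otimes> inv x \<notin> \<B> \<longrightarrow> (g \<otimes> inv x) \<otimes> (t \<otimes> inv (v x)) \<notin> X"
      by blast
  qed
  ultimately show ?thesis by blast
qed

end
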